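(* Let $\mathfrak{M}$ be a finite measurable relation algebra. If $\mathfrak{M}$ can be embedded into a simple relation algebra $\mathfrak{A}$, then $\mathfrak{A}$ is finite and measurable.
   Context: A relation algebra is an algebra $\mathfrak{A}=\langle A,+,-,;,{}^{\smile},1'\rangle$ such that: $\langle A,+,-\rangle$ is a Boolean algebra ($+$ is join, $-$ is complement; $\le,0,1,\cdot$ have their usual Boolean meaning); $\langle A,;,{}^{\smile},1'\rangle$ is an involuted monoid, i.e. $;$ is associative with two-sided identity $1'$, and $x^{\smile\smile}=x$, $(x;y)^{\smile}=y^{\smile};x^{\smile}$; the operations $;$ and ${}^{\smile}$ are additive (distribute over $+$ in each argument) and normal (give $0$ when an argument is $0$); and $r^{\smile};-(r;s)\le -s$ for all $r,s\in A$. A relation algebra is simple if it has exactly two congruences. An element $y$ of a relation algebra is functional if $y^{\smile};y\le 1'$. A relation algebra is measurable if the identity constant $1'$ is the supremum of atoms, and each atom $x\le 1'$ is measurable in the sense that $x;1;x$ is the supremum of the functional elements below it. *)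

theory Defs
  imports Main "HOL-Library.Lub_Glb"
begin

text \<open>The Boolean part is the library class \<open>boolean_algebra\<close>: \<open>sup\<close> is $+$, \<open>inf\<close> is the
  meet, \<open>bot\<close> is $0$ and \<open>top\<close> is $1$.  That class does not require \<open>bot \<noteq> top\<close>, so the
  one-element relation algebra is included.\<close>

class relation_algebra = boolean_algebra +
  fixes rcomp :: "'a \<Rightarrow> 'a \<Rightarrow> 'a"  (infixl ";;" 75)
    and rconv :: "'a \<Rightarrow> 'a"  ("(_\<^sup>\<smile>)" [1000] 999)
    and rident :: "'a"  ("1''")
  assumes rcomp_assoc: "(x ;; y) ;; z = x ;; (y ;; z)"
    and rident_left: "1' ;; x = x"
    and rident_right: "x ;; 1' = x"
    and rconv_rconv: "(x\<^sup>\<smile>)\<^sup>\<smile> = x"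
    and rconv_rcomp: "(x ;; y)\<^sup>\<smile> = y\<^sup>\<smile> ;; x\<^sup>\<smile>"
    and rcomp_sup_left: "sup x y ;; z = sup (x ;; z) (y ;; z)"
    and rcomp_sup_right: "x ;; sup y z = sup (x ;; y) (x ;; z)"
    and rconv_sup: "(sup x y)\<^sup>\<smile> = sup (x\<^sup>\<smile>) (y\<^sup>\<smile>)"
    and rcomp_bot_left: "bot ;; x = bot"
    and rcomp_bot_right: "x ;; bot = bot"
    and rconv_bot: "bot\<^sup>\<smile> = bot"
    and rcomp_residual: "r\<^sup>\<smile> ;; (- (r ;; s)) \<le> - s"

definition ra_congruence :: "('a::relation_algebra \<times> 'a) set \<Rightarrow> bool" where
  "ra_congruence R \<longleftrightarrow>
     equiv UNIV R \<and>
     (\<forall>x x' y y'. (x, x') \<in> R \<longrightarrow> (y, y') \<in> R \<longrightarrow> (sup x y, sup x' y') \<in> R) \<and>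
     (\<forall>x x'. (x, x') \<in> R \<longrightarrow> (- x, - x') \<in> R) \<and>
     (\<forall>x x' y y'. (x, x') \<in> R \<longrightarrow> (y, y') \<in> R \<longrightarrow> (x ;; y, x' ;; y') \<in> R) \<and>
     (\<forall>x x'. (x, x') \<in> R \<longrightarrow> (x\<^sup>\<smile>, x'\<^sup>\<smile>) \<in> R)"

definition simple_ra :: "'a::relation_algebra itself \<Rightarrow> bool" where
  "simple_ra _ \<longleftrightarrow> card {R :: ('a \<times> 'a) set. ra_congruence R} = 2"

definition ra_embedding :: "('a::relation_algebra \<Rightarrow> 'b::relation_algebra) \<Rightarrow> bool" where
  "ra_embedding h \<longleftrightarrow>
     inj h \<and>
     (\<forall>x y. h (sup x y) = sup (h x) (h y)) \<and>
     (\<forall>x. h (- x) = - h x) \<and>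
     (\<forall>x y. h (x ;; y) = h x ;; h y) \<and>
     (\<forall>x. h (x\<^sup>\<smile>) = (h x)\<^sup>\<smile>) \<and>
     h 1' = 1'"

definition ra_atom :: "'a::relation_algebra \<Rightarrow> bool" where
  "ra_atom x \<longleftrightarrow> x \<noteq> bot \<and> (\<forall>y. y \<le> x \<longrightarrow> y = bot \<or> y = x)"

definition functional :: "'a::relation_algebra \<Rightarrow> bool" where
  "functional y \<longleftrightarrow> y\<^sup>\<smile> ;; y \<le> 1'"

text \<open>A relation algebra need not be complete, so suprema are stated with the relational
  \<open>isLub\<close>, which also asserts that the supremum exists.\<close>

definition measurable_atom :: "'a::relation_algebra \<Rightarrow> bool" where
  "measurable_atom x \<longleftrightarrow>
     isLub UNIV {y. functional y \<and> y \<le> x ;; top ;; x} (x ;; top ;; x)"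

definition measurable_ra :: "'a::relation_algebra itself \<Rightarrow> bool" where
  "measurable_ra _ \<longleftrightarrow>
     isLub UNIV {x :: 'a. ra_atom x \<and> x \<le> 1'} 1' \<and>
     (\<forall>x :: 'a. ra_atom x \<longrightarrow> x \<le> 1' \<longrightarrow> measurable_atom x)"

end

theory Submission
  imports Defs
begin

text \<open>
  Identify \<open>\<MM>\<close> with its image in the simple algebra \<open>\<AA>\<close>.  The identity \<open>1'\<close> is a finite join of
  elements \<open>x\<close> (the subidentity atoms of \<open>\<MM>\<close>, which need not be atoms of \<open>\<AA>\<close>), and each square
  \<open>x ;; top ;; x\<close> is a finite join of functional elements; both are equations between finite joins,
  so they survive the embedding.

  \<^emph>\<open>Finiteness.\<close>  Fix two such elements \<open>x\<close> and \<open>y\<close>, whose squares are the joins of the finite sets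
  \<open>F\<close> and \<open>G\<close> of functional elements.  If \<open>d \<noteq> bot\<close> lies below \<open>x ;; top ;; y\<close>, then simplicity
  gives \<open>top ;; d ;; top = top\<close>, whence \<open>x ;; top ;; y \<le> (x ;; top ;; x) ;; d ;; (y ;; top ;; y)\<close>:
  the rectangle is covered by the finitely many translates \<open>f ;; d ;; g\<^sup>\<smile>\<close> of \<open>d\<close>, with \<open>f \<in> F\<close> and
  \<open>g \<in> G\<close>.  Each translation maps disjoint elements to disjoint elements because \<open>f\<close> and \<open>g\<close> are
  functional.  Given pairwise disjoint nonzero elements \<open>d\<^sub>1, \<dots>, d\<^sub>m\<close> below the rectangle, the covering
  property, used \<open>m\<close> times, yields a nonzero \<open>z\<close> below some translate of every \<open>d\<^sub>k\<close>; no translation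
  can be used for two of them, so \<open>m \<le> card F * card G\<close>
  (lemma \<open>card_le_of_covering_disjoint_maps\<close>).  A Boolean interval with such a bound is finite
  (lemma \<open>finite_interval_of_bounded_disjoint\<close>), and \<open>top\<close> is a finite join of rectangles.

  \<^emph>\<open>Measurability.\<close>  A finite Boolean algebra is atomic, so \<open>1'\<close> is the join of the atoms below it.
  An atom \<open>a \<le> 1'\<close> of \<open>\<AA>\<close> lies below one of the \<open>x\<close>, and then \<open>a ;; top ;; a\<close> is the join of the
  elements \<open>a ;; f ;; a\<close> for \<open>f \<in> F\<close>, which are functional.
\<close>

section \<open>Finite joins\<close>

text \<open>Adjoining \<open>bot\<close> makes the join of the empty set meaningful, as \<open>Sup_fin\<close> requires.\<close>

lemma isLub_finite_eq_Sup_fin: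
  fixes t :: "'a::bounded_lattice"
  assumes "finite F" "isLub UNIV F t"
  shows "t = Sup_fin (insert bot F)"
proof (rule antisym)
  have "F *<= Sup_fin (insert bot F)"
    using assms(1) by (auto simp: setle_def intro: Sup_fin.coboundedI)
  then show "t \<le> Sup_fin (insert bot F)"
    using assms(2) by (auto simp: isLub_def leastP_def setge_def isUb_def)
  show "Sup_fin (insert bot F) \<le> t"
    using assms by (auto simp: isLub_def leastP_def setle_def isUb_def intro!: Sup_fin.boundedI)
qed

lemma additive_Sup_fin:
  fixes k :: "'a::lattice \<Rightarrow> 'b::lattice"
  assumes add: "\<And>u v. k (sup u v) = sup (k u) (k v)"
    and "finite F" "F \<noteq> {}"
  shows "k (Sup_fin F) = Sup_fin (k ` F)"
  using assms(2,3) by (induction rule: finite_ne_induct) (simp_all add: add)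

text \<open>Were \<open>z\<close> disjoint from every \<open>k f\<close>, it would be disjoint from their join \<open>k (Sup_fin F)\<close>, hence
  from itself.\<close>

lemma meets_member_of_additive_image:
  fixes k :: "'a::lattice \<Rightarrow> 'b::boolean_algebra"
  assumes add: "\<And>u v. k (sup u v) = sup (k u) (k v)"
    and "finite F" "F \<noteq> {}" "z \<le> k (Sup_fin F)" "z \<noteq> bot"
  shows "\<exists>f\<in>F. inf z (k f) \<noteq> bot"
proof (rule ccontr)
  assume "\<not> ?thesis"
  then have *: "\<And>f. f \<in> F \<Longrightarrow> k f \<le> - z"
    by (metis inf.commute inf_shunt)
  have "k (Sup_fin F) = Sup_fin (k ` F)"
    by (rule additive_Sup_fin) (use add assms in auto)
  also have "\<dots> \<le> - z"
    using assms * by (intro Sup_fin.boundedI) auto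
  finally have "z \<le> - z" using assms(4) by simp
  then show False using assms(5) by (metis inf.idem inf_shunt)
qed

lemma finite_interval_sup:
  fixes s t :: "'a::distrib_lattice"
  assumes "finite {..s}" "finite {..t}"
  shows "finite {..sup s t}"
proof (rule finite_subset)
  show "{..sup s t} \<subseteq> (\<lambda>(u, v). sup u v) ` ({..s} \<times> {..t})"
  proof
    fix z assume "z \<in> {..sup s t}"
    then have "z = sup (inf z s) (inf z t)"
      by (metis atMost_iff inf.orderE inf_sup_distrib1)
    then show "z \<in> (\<lambda>(u, v). sup u v) ` ({..s} \<times> {..t})"
      by (intro image_eqI[where x = "(inf z s, inf z t)"]) auto
  qed
  show "finite ((\<lambda>(u, v). sup u v) ` ({..s} \<times> {..t}))"
    using assms by blast
qed

lemma finite_interval_Sup_fin: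
  fixes k :: "'a::lattice \<Rightarrow> 'b::distrib_lattice"
  assumes add: "\<And>u v. k (sup u v) = sup (k u) (k v)"
    and "finite F" "F \<noteq> {}" "\<And>f. f \<in> F \<Longrightarrow> finite {..k f}"
  shows "finite {..k (Sup_fin F)}"
  using assms(2-)
proof (induction rule: finite_ne_induct)
  case (insert f F)
  then show ?case
    using finite_interval_sup[of "k f" "k (Sup_fin F)"] by (simp add: add)
qed simp

section \<open>Disjoint families in Boolean algebras\<close>

definition disjoint_below :: "'a::boolean_algebra \<Rightarrow> 'a set \<Rightarrow> bool" where
  "disjoint_below t D \<longleftrightarrow>
     finite D \<and> (\<forall>d\<in>D. d \<noteq> bot \<and> d \<le> t) \<and> pairwise (\<lambda>a b. inf a b = bot) D"

text \<open>A disjoint family \<open>D\<close> of maximal size admits no proper refinement: none of its members splits,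
  and no further element is disjoint from all of them.  Hence an element of the interval is determined
  by the members of \<open>D\<close> below it.\<close>

lemma finite_interval_of_bounded_disjoint:
  fixes t :: "'a::boolean_algebra"
  assumes bound: "\<And>D. disjoint_below t D \<Longrightarrow> card D \<le> N"
  shows "finite {..t}"
proof -
  have "disjoint_below t {}" by (simp add: disjoint_below_def)
  then obtain D where D: "disjoint_below t D"
    and max: "\<And>D'. disjoint_below t D' \<Longrightarrow> card D' \<le> card D"
    using ex_has_greatest_nat[of "disjoint_below t" "{}" card "Suc N"] bound
    by (auto simp: less_Suc_eq_le)
  have fin: "finite D" using D by (simp add: disjoint_below_def)
  have meets: "\<exists>d\<in>D. inf z d \<noteq> bot" if "z \<noteq> bot" "z \<le> t" for z
  proof (rule ccontr)
    assume none: "\<not> ?thesis"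
    then have "z \<notin> D" using that by auto
    moreover have "disjoint_below t (insert z D)"
      using D none that by (auto simp: disjoint_below_def pairwise_insert inf_commute)
    ultimately show False using max[of "insert z D"] fin by simp
  qed
  have unsplit: "inf d z = bot \<or> d \<le> z" if "d \<in> D" for d z
  proof (rule ccontr)
    assume split: "\<not> ?thesis"
    define a b where "a = inf d z" and "b = inf d (- z)"
    have ab: "a \<noteq> bot" "b \<noteq> bot" "a \<le> d" "b \<le> d" "inf a b = bot"
      using split by (auto simp: a_def b_def inf_shunt intro: inf.coboundedI2)
    have dt: "d \<le> t" and other: "\<And>e. e \<in> D - {d} \<Longrightarrow> inf e d = bot"
      using D that by (auto simp: disjoint_below_def pairwise_def)
    have off: "inf e c = bot" if "e \<in> D - {d}" "c \<le> d" for e c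
      using inf_mono[OF order_refl[of e] that(2)] other[OF that(1)] by (simp add: bot_unique)
    have both: "inf a b = bot \<and> inf b a = bot"
      "\<forall>e\<in>D - {d}. inf a e = bot \<and> inf e a = bot \<and> inf b e = bot \<and> inf e b = bot"
      using ab off by (simp_all add: inf_commute)
    have "a \<noteq> b" using ab by auto
    have new: "a \<notin> D - {d}" "b \<notin> D - {d}"
      using off[of a a] off[of b b] ab by auto
    have "disjoint_below t (insert a (insert b (D - {d})))"
      using D ab(1,2) both order_trans[OF ab(3) dt] order_trans[OF ab(4) dt]
        pairwise_subset[of _ D "D - {d}"]
      unfolding disjoint_below_def by (simp add: pairwise_insert) blast
    moreover have "card (insert a (insert b (D - {d}))) = Suc (card D)"
      using new \<open>a \<noteq> b\<close> fin card_Suc_Diff1[OF fin that] by simp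
    ultimately show False using max[of "insert a (insert b (D - {d}))"] by linarith
  qed
  have determined: "z \<le> w" if "z \<le> t" and sub: "{d\<in>D. d \<le> z} \<subseteq> {d\<in>D. d \<le> w}" for z w
  proof (rule ccontr)
    assume "\<not> z \<le> w"
    then have "inf z (- w) \<noteq> bot" by (simp add: inf_shunt)
    moreover have "inf z (- w) \<le> t" using \<open>z \<le> t\<close> by (simp add: inf.coboundedI1)
    ultimately obtain d where d: "d \<in> D" "inf (inf z (- w)) d \<noteq> bot"
      using meets by blast
    moreover have "inf (inf z (- w)) d \<le> inf d z" "inf (inf z (- w)) d \<le> inf d (- w)"
      by (auto intro: le_infI1)
    ultimately have "inf d z \<noteq> bot" "inf d (- w) \<noteq> bot"
      by (metis bot_unique)+
    then have "d \<le> z" "\<not> d \<le> w"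
      using unsplit[OF d(1)] by (auto simp: inf_shunt)
    then show False using sub d(1) by blast
  qed
  have "inj_on (\<lambda>z. {d\<in>D. d \<le> z}) {..t}"
  proof (rule inj_onI)
    fix z w assume *: "z \<in> {..t}" "w \<in> {..t}" "{d\<in>D. d \<le> z} = {d\<in>D. d \<le> w}"
    show "z = w" by (rule antisym; rule determined) (use * in auto)
  qed
  then show ?thesis
    by (rule inj_on_finite[where B = "Pow D"]) (use fin in auto)
qed

text \<open>Intersecting successively with an image of each member of \<open>D\<close> produces a nonzero \<open>z\<close> that lies
  below one image of every member.  Distinct members must use distinct maps, since the images under a
  common map are disjoint.\<close>

lemma card_le_of_covering_disjoint_maps:
  fixes t :: "'a::boolean_algebra" and \<phi> :: "'i \<Rightarrow> 'a \<Rightarrow> 'a"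
  assumes "finite I"
    and disj: "\<And>i a b. i \<in> I \<Longrightarrow> inf a b = bot \<Longrightarrow> inf (\<phi> i a) (\<phi> i b) = bot"
    and cover: "\<And>d z. d \<noteq> bot \<Longrightarrow> d \<le> t \<Longrightarrow> z \<noteq> bot \<Longrightarrow> z \<le> t \<Longrightarrow> \<exists>i\<in>I. inf z (\<phi> i d) \<noteq> bot"
    and D: "disjoint_below t D"
  shows "card D \<le> card I"
proof (cases "t = bot")
  case True
  then have "D = {}" using D by (auto simp: disjoint_below_def bot_unique)
  then show ?thesis by simp
next
  case False
  have "finite D" and below: "\<forall>d\<in>D. d \<noteq> bot \<and> d \<le> t"
    using D by (auto simp: disjoint_below_def)
  then have "\<exists>z c. z \<noteq> bot \<and> z \<le> t \<and> (\<forall>d\<in>D. c d \<in> I \<and> z \<le> \<phi> (c d) d)"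
  proof (induction rule: finite_induct)
    case empty
    then show ?case using False by auto
  next
    case (insert d D)
    then obtain z c where z: "z \<noteq> bot" "z \<le> t" and c: "\<forall>d\<in>D. c d \<in> I \<and> z \<le> \<phi> (c d) d"
      by auto
    obtain i where i: "i \<in> I" "inf z (\<phi> i d) \<noteq> bot"
      using cover[of d z] z insert.prems by auto
    have "\<forall>e\<in>insert d D. (c(d := i)) e \<in> I \<and> inf z (\<phi> i d) \<le> \<phi> ((c(d := i)) e) e"
      using c i insert.hyps by (auto intro: inf.coboundedI1)
    then show ?case
      using i z by (metis inf.coboundedI1)
  qed
  then obtain z c where z: "z \<noteq> bot" and c: "\<forall>d\<in>D. c d \<in> I \<and> z \<le> \<phi> (c d) d"
    by auto
  have "inj_on c D"
  proof (rule inj_onI, rule ccontr)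
    fix d e assume *: "d \<in> D" "e \<in> D" "c d = c e" "d \<noteq> e"
    then have "inf d e = bot" using D by (auto simp: disjoint_below_def pairwise_def)
    then have "inf (\<phi> (c d) d) (\<phi> (c d) e) = bot" using disj c * by blast
    moreover have "z \<le> inf (\<phi> (c d) d) (\<phi> (c d) e)" using c * by auto
    ultimately show False using z by (simp add: bot_unique)
  qed
  then show ?thesis
    by (rule card_inj_on_le) (use c \<open>finite I\<close> in auto)
qed

lemma finite_atom_below:
  fixes z :: "'a::relation_algebra"
  assumes "finite (UNIV :: 'a set)" "z \<noteq> bot"
  shows "\<exists>a \<le> z. ra_atom a"
proof -
  have "finite {y :: 'a. y \<noteq> bot}" using assms(1) by (rule rev_finite_subset) simp
  then obtain a where "a \<in> {y. y \<noteq> bot}" "a \<le> z"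
      and min: "\<forall>b\<in>{y. y \<noteq> bot}. b \<le> a \<longrightarrow> a = b"
    using finite_has_minimal2[of "{y. y \<noteq> bot}" z] assms(2) by auto
  then have "ra_atom a" unfolding ra_atom_def by blast
  with \<open>a \<le> z\<close> show ?thesis by blast
qed

section \<open>Relation-algebraic calculus\<close>

lemma rcomp_mono:
  fixes a b c d :: "'a::relation_algebra"
  assumes "a \<le> b" "c \<le> d"
  shows "a ;; c \<le> b ;; d"
  by (metis assms rcomp_sup_left rcomp_sup_right sup.absorb_iff2 sup.cobounded1 order_trans)

lemma rconv_mono:
  fixes a b :: "'a::relation_algebra"
  shows "a \<le> b \<Longrightarrow> a\<^sup>\<smile> \<le> b\<^sup>\<smile>"
  by (metis rconv_sup sup.absorb_iff2)

lemma rconv_rident: "(1' :: 'a::relation_algebra)\<^sup>\<smile> = 1'"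
  by (metis rconv_rconv rconv_rcomp rident_left)

lemma rconv_top: "(top :: 'a::relation_algebra)\<^sup>\<smile> = top"
  by (metis rconv_mono rconv_rconv top.extremum_uniqueI top_greatest)

lemma rconv_disjoint:
  fixes a b :: "'a::relation_algebra"
  assumes "inf a b = bot"
  shows "inf (a\<^sup>\<smile>) (b\<^sup>\<smile>) = bot"
proof -
  have "(inf (a\<^sup>\<smile>) (b\<^sup>\<smile>))\<^sup>\<smile> \<le> inf a b"
    using rconv_mono[of "inf (a\<^sup>\<smile>) (b\<^sup>\<smile>)" "a\<^sup>\<smile>"] rconv_mono[of "inf (a\<^sup>\<smile>) (b\<^sup>\<smile>)" "b\<^sup>\<smile>"]
    by (simp add: rconv_rconv)
  then show ?thesis by (metis assms bot_unique rconv_bot rconv_rconv)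
qed

text \<open>One half of the Schroeder equivalences; the residual axiom is this statement for the largest
  \<open>c\<close> disjoint from \<open>a ;; b\<close>, and the other half follows because \<open>\<smile>\<close> is an involution.\<close>

lemma schroeder:
  fixes a b c :: "'a::relation_algebra"
  assumes "inf (a ;; b) c = bot"
  shows "inf b (a\<^sup>\<smile> ;; c) = bot"
proof -
  have "c \<le> - (a ;; b)" using assms by (metis inf.commute inf_shunt)
  then have "a\<^sup>\<smile> ;; c \<le> - b"
    using rcomp_mono[OF order_refl] rcomp_residual order_trans by blast
  then show ?thesis by (metis inf.commute inf_shunt)
qed

lemma modular_law:
  fixes a b c :: "'a::relation_algebra"
  shows "inf (a ;; b) c \<le> a ;; inf b (a\<^sup>\<smile> ;; c)"
proof -
  let ?p = "a\<^sup>\<smile> ;; c"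
  have "b = sup (inf b ?p) (inf b (- ?p))"
    by (metis inf_sup_distrib1 inf_top_right sup_compl_top)
  then have split: "a ;; b = sup (a ;; inf b ?p) (a ;; inf b (- ?p))"
    by (metis rcomp_sup_right)
  have "inf ?p (inf b (- ?p)) = bot"
    by (metis inf.left_commute inf_bot_right inf_compl_bot)
  then have "inf (a ;; inf b (- ?p)) c = bot"
    using schroeder[of "a\<^sup>\<smile>" c "inf b (- ?p)"] by (simp add: rconv_rconv inf_commute)
  then have "inf (a ;; b) c = inf (a ;; inf b ?p) c"
    by (simp add: split inf_sup_distrib2)
  then show ?thesis by simp
qed

lemma le_rcomp_rconv_rcomp:
  fixes r :: "'a::relation_algebra"
  shows "r \<le> r ;; (r\<^sup>\<smile> ;; r)"
proof -
  have "r \<le> r ;; inf 1' (r\<^sup>\<smile> ;; r)"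
    using modular_law[of r "1'" r] by (simp add: rident_right)
  also have "\<dots> \<le> r ;; (r\<^sup>\<smile> ;; r)" by (intro rcomp_mono) auto
  finally show ?thesis .
qed

lemma subidentity_rconv:
  fixes x :: "'a::relation_algebra"
  assumes "x \<le> 1'"
  shows "x\<^sup>\<smile> = x"
proof -
  have *: "y \<le> y\<^sup>\<smile>" if "y \<le> 1'" for y :: 'a
  proof -
    have "y \<le> y ;; (y\<^sup>\<smile> ;; y)" by (rule le_rcomp_rconv_rcomp)
    also have "\<dots> \<le> 1' ;; (y\<^sup>\<smile> ;; 1')" by (intro rcomp_mono that order_refl)
    finally show ?thesis by (simp add: rident_left rident_right)
  qed
  have "x\<^sup>\<smile> \<le> 1'" using rconv_mono[OF assms] by (simp add: rconv_rident)
  from *[OF this] *[OF assms] show ?thesis by (simp add: rconv_rconv)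
qed

lemma subidentity_le_square:
  fixes x :: "'a::relation_algebra"
  assumes "x \<le> 1'"
  shows "x \<le> x ;; x"
proof -
  have "x \<le> x ;; (x\<^sup>\<smile> ;; x)" by (rule le_rcomp_rconv_rcomp)
  also have "\<dots> \<le> x ;; (1' ;; x)"
    by (intro rcomp_mono order_refl) (simp add: assms subidentity_rconv)
  finally show ?thesis by (simp add: rident_left)
qed

text \<open>A subidentity restricts the domain, and an element below \<open>x ;; s\<close> has its domain in \<open>x\<close>
  already.\<close>

lemma le_subidentity_rcomp:
  fixes x d s :: "'a::relation_algebra"
  assumes "x \<le> 1'" "d \<le> x ;; s"
  shows "d \<le> x ;; d"
proof -
  have "d = inf (x ;; s) d" using assms(2) by (simp add: inf_absorb2)
  also have "\<dots> \<le> x ;; inf s (x\<^sup>\<smile> ;; d)" by (rule modular_law)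
  also have "\<dots> \<le> x ;; (1' ;; d)"
    by (rule rcomp_mono) (auto simp: assms(1) subidentity_rconv intro!: le_infI2 rcomp_mono)
  finally show ?thesis by (simp add: rident_left)
qed

lemma le_rcomp_subidentity:
  fixes x d s :: "'a::relation_algebra"
  assumes "x \<le> 1'" "d \<le> s ;; x"
  shows "d \<le> d ;; x"
proof -
  have "d\<^sup>\<smile> \<le> x ;; s\<^sup>\<smile>"
    using rconv_mono[OF assms(2)] assms(1) by (simp add: rconv_rcomp subidentity_rconv)
  then have "d\<^sup>\<smile> \<le> x ;; d\<^sup>\<smile>" by (rule le_subidentity_rcomp[OF assms(1)])
  from rconv_mono[OF this] show ?thesis
    by (simp add: rconv_rcomp rconv_rconv assms(1) subidentity_rconv)
qed

lemma rconv_square: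
  fixes x :: "'a::relation_algebra"
  assumes "x \<le> 1'"
  shows "(x ;; top ;; x)\<^sup>\<smile> = x ;; top ;; x"
  using assms by (simp add: rconv_rcomp rconv_top subidentity_rconv rcomp_assoc)

lemma functional_bot: "functional (bot :: 'a::relation_algebra)"
  by (simp add: functional_def rcomp_bot_right)

text \<open>For relations: if \<open>f ;; a\<close> and \<open>f ;; b\<close> share a pair \<open>(p, q)\<close>, then both reach \<open>q\<close> through the
  only value of \<open>f\<close> at \<open>p\<close>, so \<open>a\<close> and \<open>b\<close> share a pair.  Abstractly, the Schroeder law moves \<open>f\<close>
  across the meet, where \<open>f\<^sup>\<smile> ;; f ;; b \<le> b\<close>.\<close>

lemma functional_rcomp_disjoint:
  fixes f a b :: "'a::relation_algebra"
  assumes "functional f" "inf a b = bot"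
  shows "inf (f ;; a) (f ;; b) = bot"
proof -
  have "f\<^sup>\<smile> ;; (f ;; b) \<le> 1' ;; b"
    using assms(1) by (metis functional_def rcomp_assoc rcomp_mono order_refl)
  then have "inf (f\<^sup>\<smile> ;; (f ;; b)) a = bot"
    using assms(2) by (metis bot_unique inf.commute inf_mono order_refl rident_left)
  then show ?thesis
    using schroeder[of "f\<^sup>\<smile>" "f ;; b" a] by (simp add: rconv_rconv inf_commute)
qed

lemma rcomp_rconv_functional_disjoint:
  fixes g a b :: "'a::relation_algebra"
  assumes "functional g" "inf a b = bot"
  shows "inf (a ;; g\<^sup>\<smile>) (b ;; g\<^sup>\<smile>) = bot"
  using rconv_disjoint[OF functional_rcomp_disjoint[OF assms(1) rconv_disjoint[OF assms(2)]]]
  by (simp add: rconv_rcomp rconv_rconv)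

lemma functional_restrict:
  fixes a f :: "'a::relation_algebra"
  assumes "functional f" "a \<le> 1'"
  shows "functional (a ;; f ;; a)"
proof -
  have "(a ;; f ;; a)\<^sup>\<smile> ;; (a ;; f ;; a) = a ;; (f\<^sup>\<smile> ;; (a ;; (a ;; (f ;; a))))"
    using assms(2) by (simp add: rconv_rcomp subidentity_rconv rcomp_assoc)
  also have "\<dots> \<le> 1' ;; (f\<^sup>\<smile> ;; (1' ;; (1' ;; (f ;; 1'))))"
    by (intro rcomp_mono order_refl assms(2))
  also have "\<dots> = f\<^sup>\<smile> ;; f" by (simp add: rident_left rident_right)
  finally show ?thesis using assms(1) by (auto simp: functional_def)
qed

section \<open>Simplicity\<close>

text \<open>The hypotheses make the elements below \<open>t\<close> an ideal closed under composition with arbitrary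
  elements and under converse.  Changing an argument only within \<open>t\<close> therefore changes the value of
  each operation only within \<open>t\<close>.\<close>

lemma ra_congruence_outside:
  fixes t :: "'a::relation_algebra"
  assumes right: "t ;; top \<le> t" and left: "top ;; t \<le> t" and conv: "t\<^sup>\<smile> \<le> t"
  shows "ra_congruence {(a, b). inf a (- t) = inf b (- t)}"
proof -
  have part: "u = sup (inf u (- t)) (inf u t)" for u
    by (metis inf_sup_distrib1 inf_top_right sup_commute sup_compl_top)
  have outside: "inf u (- t) = inf v (- t)" if "v \<le> u" "u \<le> sup v t" for u v
  proof (rule antisym)
    have "inf u (- t) \<le> inf (sup v t) (- t)" using that by (intro inf_mono) auto
    also have "\<dots> = inf v (- t)" by (simp add: inf_sup_distrib2)
    finally show "inf u (- t) \<le> inf v (- t)" .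
    show "inf v (- t) \<le> inf u (- t)" using that by (intro inf_mono) auto
  qed
  have comp: "inf (a ;; b) (- t) = inf (inf a (- t) ;; inf b (- t)) (- t)" for a b
  proof (rule outside)
    show "inf a (- t) ;; inf b (- t) \<le> a ;; b" by (intro rcomp_mono) auto
    have absorb: "inf a t ;; b \<le> t" "inf a (- t) ;; inf b t \<le> t"
      using rcomp_mono[of "inf a t" t b top] rcomp_mono[of "inf a (- t)" top "inf b t" t] left right
      by (auto intro: order_trans)
    have "a ;; b = sup (inf a (- t) ;; b) (inf a t ;; b)"
      by (metis part rcomp_sup_left)
    also have "inf a (- t) ;; b = sup (inf a (- t) ;; inf b (- t)) (inf a (- t) ;; inf b t)"
      by (metis part rcomp_sup_right)
    finally show "a ;; b \<le> sup (inf a (- t) ;; inf b (- t)) t"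
      using absorb by (auto intro: le_supI2)
  qed
  have converse: "inf (a\<^sup>\<smile>) (- t) = inf ((inf a (- t))\<^sup>\<smile>) (- t)" for a
  proof (rule outside)
    show "(inf a (- t))\<^sup>\<smile> \<le> a\<^sup>\<smile>" by (intro rconv_mono) auto
    have "a\<^sup>\<smile> = sup ((inf a (- t))\<^sup>\<smile>) ((inf a t)\<^sup>\<smile>)" by (metis part rconv_sup)
    moreover have "(inf a t)\<^sup>\<smile> \<le> t" using conv rconv_mono[of "inf a t" t] by (auto intro: order_trans)
    ultimately show "a\<^sup>\<smile> \<le> sup ((inf a (- t))\<^sup>\<smile>) t"
      by (metis order_refl sup_mono)
  qed
  have compl: "inf (- a) (- t) = inf (- inf a (- t)) (- t)" for a
    by (simp add: inf_sup_distrib2)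
  show ?thesis
    unfolding ra_congruence_def
  proof (intro conjI allI impI)
    show "equiv UNIV {(a, b). inf a (- t) = inf b (- t)}"
      by (auto simp: equiv_def refl_on_def sym_def trans_def)
  qed (auto simp: inf_sup_distrib2 intro: compl[THEN trans] comp[THEN trans] converse[THEN trans]
       simp del: compl_inf, (metis compl comp converse)+)
qed

text \<open>The ideal generated by \<open>r\<close> consists of the elements below \<open>t = top ;; r ;; top\<close>.  Its congruence
  identifies \<open>t\<close> with \<open>bot\<close> and is one of the two trivial congruences; since \<open>bot \<noteq> r \<le> t\<close>, it
  cannot be the identity, so it identifies everything and \<open>t\<close> is \<open>top\<close>.\<close>

lemma simple_ra_top_rcomp_top:
  fixes r :: "'a::relation_algebra"
  assumes "simple_ra TYPE('a)" "r \<noteq> bot"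
  shows "top ;; r ;; top = top"
proof -
  define t where "t = top ;; r ;; top"
  define R where "R = {(a, b). inf a (- t) = inf b (- t)}"
  have "t ;; top \<le> t" "top ;; t \<le> t"
    unfolding t_def by (metis rcomp_assoc rcomp_mono order_refl top_greatest)+
  moreover have "t\<^sup>\<smile> \<le> t"
  proof -
    have "r\<^sup>\<smile> \<le> r\<^sup>\<smile> ;; (r ;; r\<^sup>\<smile>)"
      using le_rcomp_rconv_rcomp[of "r\<^sup>\<smile>"] by (simp add: rconv_rconv)
    also have "\<dots> \<le> top ;; (r ;; top)" by (intro rcomp_mono) auto
    finally have "top ;; (r\<^sup>\<smile> ;; top) \<le> top ;; ((top ;; (r ;; top)) ;; top)"
      by (intro rcomp_mono order_refl)
    also have "\<dots> = (top ;; top) ;; (r ;; (top ;; top))" by (simp add: rcomp_assoc)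
    also have "\<dots> \<le> top ;; (r ;; top)" by (intro rcomp_mono) auto
    finally show ?thesis by (simp add: t_def rconv_rcomp rconv_top rcomp_assoc)
  qed
  ultimately have cong: "ra_congruence R"
    unfolding R_def by (rule ra_congruence_outside)
  have Id: "ra_congruence (Id :: ('a \<times> 'a) set)" and UNIV: "ra_congruence (UNIV :: ('a \<times> 'a) set)"
    by (auto simp: ra_congruence_def equiv_def refl_on_def sym_def trans_def)
  have two: "card {R :: ('a \<times> 'a) set. ra_congruence R} = 2"
    using assms(1) by (simp add: simple_ra_def)
  have "R = Id \<or> R = UNIV"
  proof (cases "(Id :: ('a \<times> 'a) set) = UNIV")
    case True
    moreover have "Id \<subseteq> R"
      using cong by (auto simp: ra_congruence_def equiv_def refl_on_def)
    ultimately show ?thesis by blast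
  next
    case False
    have "{Id, UNIV} = {R :: ('a \<times> 'a) set. ra_congruence R}"
      by (rule card_subset_eq) (use two False Id UNIV in \<open>auto intro: card_ge_0_finite\<close>)
    then show ?thesis using cong by blast
  qed
  then show ?thesis
  proof
    assume "R = Id"
    moreover have "(t, bot) \<in> R" by (simp add: R_def)
    ultimately have "t = bot" by simp
    moreover have "r \<le> t"
    proof -
      have "1' ;; r ;; 1' \<le> t" unfolding t_def by (intro rcomp_mono) auto
      then show ?thesis by (simp add: rident_left rident_right)
    qed
    ultimately show ?thesis using assms(2) by (simp add: bot_unique)
  next
    assume "R = UNIV"
    then have "(top, bot) \<in> R" by simp
    then have "- t = bot" by (simp add: R_def)
    then show ?thesis by (metis compl_bot_eq double_compl t_def)
  qed
qed

section \<open>Rectangles and squares in a simple algebra\<close>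

text \<open>Simplicity makes the translates \<open>f ;; d ;; g\<^sup>\<smile>\<close> of any nonzero \<open>d\<close> cover the rectangle, and
  functionality makes translation preserve disjointness, so the pigeonhole bound applies.\<close>

lemma finite_rectangle:
  fixes x y :: "'a::relation_algebra"
  assumes simple: "simple_ra TYPE('a)"
    and x: "x \<le> 1'" and y: "y \<le> 1'"
    and F: "finite F" "F \<noteq> {}" "\<And>f. f \<in> F \<Longrightarrow> functional f" "x ;; top ;; x = Sup_fin F"
    and G: "finite G" "G \<noteq> {}" "\<And>g. g \<in> G \<Longrightarrow> functional g" "y ;; top ;; y = Sup_fin G"
  shows "finite {..x ;; top ;; y}"
proof (rule finite_interval_of_bounded_disjoint)
  fix D assume D: "disjoint_below (x ;; top ;; y) D"
  show "card D \<le> card (F \<times> G)"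
  proof (rule card_le_of_covering_disjoint_maps[where \<phi> = "\<lambda>(f, g) d. f ;; d ;; g\<^sup>\<smile>", OF _ _ _ D])
    show "finite (F \<times> G)" using F G by simp
    show "inf ((\<lambda>(f, g) d. f ;; d ;; g\<^sup>\<smile>) i a) ((\<lambda>(f, g) d. f ;; d ;; g\<^sup>\<smile>) i b) = bot"
      if "i \<in> F \<times> G" "inf a b = bot" for i a b
      using that F(3) G(3)
      by (auto intro: functional_rcomp_disjoint rcomp_rconv_functional_disjoint)
  next
    fix d z
    assume d: "d \<noteq> bot" "d \<le> x ;; top ;; y" and z: "z \<noteq> bot" "z \<le> x ;; top ;; y"
    have "d \<le> x ;; d" using le_subidentity_rcomp[OF x] d(2) by (metis rcomp_assoc)
    also have "\<dots> \<le> x ;; (d ;; y)"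
      using le_rcomp_subidentity[OF y d(2)] by (intro rcomp_mono order_refl)
    finally have xdy: "d \<le> x ;; (d ;; y)" .
    have "x ;; top ;; y = x ;; (top ;; d ;; top) ;; y"
      using simple_ra_top_rcomp_top[OF simple d(1)] by simp
    also have "\<dots> \<le> x ;; (top ;; (x ;; (d ;; y)) ;; top) ;; y"
      by (intro rcomp_mono order_refl xdy)
    also have "\<dots> = (x ;; top ;; x) ;; d ;; (y ;; top ;; y)"
      by (simp add: rcomp_assoc)
    finally have "z \<le> Sup_fin F ;; d ;; (y ;; top ;; y)"
      using z(2) F(4) by (metis order_trans)
    then obtain f where f: "f \<in> F" "inf z (f ;; d ;; (y ;; top ;; y)) \<noteq> bot"
      using meets_member_of_additive_image[of "\<lambda>u. u ;; d ;; (y ;; top ;; y)" F z] F z(1)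
      by (auto simp: rcomp_sup_left)
    have "inf z (f ;; d ;; (y ;; top ;; y)) \<le> f ;; d ;; (Sup_fin G)\<^sup>\<smile>"
      using rconv_square[OF y] G(4) by (metis inf.cobounded2)
    then obtain g where "g \<in> G"
      "inf (inf z (f ;; d ;; (y ;; top ;; y))) (f ;; d ;; g\<^sup>\<smile>) \<noteq> bot"
      using meets_member_of_additive_image[of "\<lambda>u. f ;; d ;; u\<^sup>\<smile>" G] G f(2)
      by (auto simp: rcomp_sup_right rconv_sup)
    moreover from this have "inf z (f ;; d ;; g\<^sup>\<smile>) \<noteq> bot"
      by (metis inf.assoc inf.left_commute inf_bot_right)
    ultimately show "\<exists>i\<in>F \<times> G. inf z ((\<lambda>(f, g) d. f ;; d ;; g\<^sup>\<smile>) i d) \<noteq> bot"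
      using f(1) by (intro bexI[of _ "(f, g)"]) auto
  qed
qed

text \<open>Restricting the functional elements that join to the square on \<open>x\<close> gives functional elements
  that join to the square on any smaller \<open>a\<close>.\<close>

lemma measurable_atom_below:
  fixes a x :: "'a::relation_algebra"
  assumes "a \<le> x" "x \<le> 1'"
    and F: "finite F" "F \<noteq> {}" "\<And>f. f \<in> F \<Longrightarrow> functional f" "x ;; top ;; x = Sup_fin F"
  shows "measurable_atom a"
proof -
  have a: "a \<le> 1'" using assms by auto
  have least: "a ;; top ;; a \<le> u"
    if ub: "\<And>f. functional f \<Longrightarrow> f \<le> a ;; top ;; a \<Longrightarrow> f \<le> u" for u
  proof -
    have sq: "a \<le> a ;; x" "a \<le> x ;; a"
      using subidentity_le_square[OF a] assms(1) by (meson order_refl order_trans rcomp_mono)+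
    have "a ;; top ;; a \<le> (a ;; x) ;; top ;; (x ;; a)"
      by (intro rcomp_mono order_refl sq)
    also have "\<dots> = a ;; Sup_fin F ;; a" by (simp flip: F(4) add: rcomp_assoc)
    also have "\<dots> = Sup_fin ((\<lambda>f. a ;; f ;; a) ` F)"
      by (rule additive_Sup_fin) (use F in \<open>auto simp: rcomp_sup_left rcomp_sup_right\<close>)
    also have "\<dots> \<le> u"
    proof (rule Sup_fin.boundedI)
      fix v assume "v \<in> (\<lambda>f. a ;; f ;; a) ` F"
      then obtain f where "f \<in> F" "v = a ;; f ;; a" by auto
      then show "v \<le> u"
        using functional_restrict[OF F(3) a] by (auto intro!: ub rcomp_mono)
    qed (use F in auto)
    finally show ?thesis .
  qed
  then show ?thesis
    by (auto simp: measurable_atom_def isLub_def leastP_def isUb_def setle_def setge_def)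
qed

section \<open>Transfer along the embedding\<close>

lemma ra_embedding_bot_top:
  fixes h :: "'m::relation_algebra \<Rightarrow> 'a::relation_algebra"
  assumes "ra_embedding h"
  shows "h bot = bot" and "h top = top"
proof -
  have h: "h (sup x y) = sup (h x) (h y)" "h (- x) = - h x" for x y
    using assms by (auto simp: ra_embedding_def)
  show top: "h top = top" by (metis h sup_compl_top)
  show "h bot = bot" by (metis h(2) top compl_top_eq)
qed

theorem theorem3p1:
  assumes "finite (UNIV :: 'm::relation_algebra set)"
    and "measurable_ra TYPE('m)"
    and "simple_ra TYPE('a::relation_algebra)"
    and "\<exists>h :: 'm \<Rightarrow> 'a. ra_embedding h"
  shows "finite (UNIV :: 'a set) \<and> measurable_ra TYPE('a)"
proof -
  from assms(4) obtain h :: "'m \<Rightarrow> 'a" where emb: "ra_embedding h" by auto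
  have h_sup: "\<And>x y. h (sup x y) = sup (h x) (h y)" and h_comp: "\<And>x y. h (x ;; y) = h x ;; h y"
    and h_conv: "\<And>x. h (x\<^sup>\<smile>) = (h x)\<^sup>\<smile>" and h_id: "h 1' = 1'"
    using emb by (auto simp: ra_embedding_def)
  note h_bot_top = ra_embedding_bot_top[OF emb]
  have h_mono: "h x \<le> h y" if "x \<le> y" for x y
    using that by (metis h_sup sup.absorb_iff2)
  have h_functional: "functional (h f)" if "functional f" for f
    using that by (metis functional_def h_mono h_comp h_conv h_id)
  have fin: "finite S" for S :: "'m set" using assms(1) by (rule rev_finite_subset) simp
  have h_Sup: "h (Sup_fin S) = Sup_fin (h ` S)" if "S \<noteq> {}" for S
    by (rule additive_Sup_fin) (use h_sup fin that in auto)

  \<comment> \<open>Including \<open>bot\<close> among the units keeps their joins meaningful when \<open>1' = bot\<close>.\<close>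
  define E where "E = h ` insert bot {x. ra_atom x \<and> x \<le> 1'}"
  have E: "finite E" "E \<noteq> {}" using fin by (auto simp: E_def)
  have "(1' :: 'm) = Sup_fin (insert bot {x. ra_atom x \<and> x \<le> 1'})"
    using assms(2) by (intro isLub_finite_eq_Sup_fin fin) (simp add: measurable_ra_def)
  then have id_E: "(1' :: 'a) = Sup_fin E"
    unfolding E_def by (metis h_Sup h_id insert_not_empty)
  have E_sub: "x \<le> 1'" if "x \<in> E" for x
    using Sup_fin.coboundedI[OF E(1) that] id_E by simp

  have square: "\<exists>F. finite F \<and> F \<noteq> {} \<and> (\<forall>f\<in>F. functional f) \<and> x ;; top ;; x = Sup_fin F"
    if "x \<in> E" for x
  proof -
    consider "x = bot" | y where "x = h y" "ra_atom y" "y \<le> 1'"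
      using \<open>x \<in> E\<close> h_bot_top by (auto simp: E_def)
    then show ?thesis
    proof cases
      case 1
      then show ?thesis
        by (intro exI[of _ "{bot}"]) (simp add: functional_bot rcomp_bot_right)
    next
      case 2
      let ?F = "insert bot {f. functional f \<and> f \<le> y ;; top ;; y}"
      have "y ;; top ;; y = Sup_fin ?F"
        using assms(2) 2
        by (intro isLub_finite_eq_Sup_fin fin) (simp add: measurable_ra_def measurable_atom_def)
      then have "x ;; top ;; x = Sup_fin (h ` ?F)"
        by (metis 2(1) h_Sup h_comp h_bot_top(2) insert_not_empty)
      then show ?thesis
        using fin by (intro exI[of _ "h ` ?F"]) (auto intro: h_functional functional_bot)
    qed
  qed

  have rect: "finite {..x ;; top ;; y}" if "x \<in> E" "y \<in> E" for x y
    using square[OF that(1)] square[OF that(2)] finite_rectangle[OF assms(3) E_sub E_sub, OF that]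
    by blast
  have "finite {..x ;; top ;; Sup_fin E}" if "x \<in> E" for x
    by (rule finite_interval_Sup_fin) (use E rect that in \<open>auto simp: rcomp_sup_right\<close>)
  then have "finite {..Sup_fin E ;; top ;; Sup_fin E}"
    by (intro finite_interval_Sup_fin[where k = "\<lambda>u. u ;; top ;; Sup_fin E"])
      (use E in \<open>auto simp: rcomp_sup_left\<close>)
  then have "finite {..top :: 'a}"
    by (simp flip: id_E add: rident_left rident_right)
  then have finA: "finite (UNIV :: 'a set)"
    by (simp add: atMost_def)

  have "isLub UNIV {x :: 'a. ra_atom x \<and> x \<le> 1'} 1'"
  proof -
    have "1' \<le> u" if ub: "\<And>x. ra_atom x \<Longrightarrow> x \<le> 1' \<Longrightarrow> x \<le> u" for u :: 'a
    proof (rule ccontr)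
      assume "\<not> 1' \<le> u"
      then have "inf 1' (- u) \<noteq> bot" by (simp add: inf_shunt)
      then obtain a where a: "a \<le> inf 1' (- u)" "ra_atom a"
        using finite_atom_below[OF finA] by blast
      then have "a \<le> u" "a \<le> - u" using ub by auto
      then have "a \<le> bot" by (metis inf_compl_bot le_inf_iff)
      then show False using a(2) by (auto simp: ra_atom_def bot_unique)
    qed
    then show ?thesis
      by (auto simp: isLub_def leastP_def isUb_def setle_def setge_def)
  qed
  moreover have "measurable_atom a" if a: "ra_atom a" "a \<le> 1'" for a :: 'a
  proof -
    have "a \<noteq> bot" using a(1) by (simp add: ra_atom_def)
    then obtain x where x: "x \<in> E" "inf a x \<noteq> bot"
      using meets_member_of_additive_image[of "\<lambda>u. u" E a] E id_E a(2) by auto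
    then have "a \<le> x"
      using a(1) unfolding ra_atom_def by (metis inf.cobounded1 inf.absorb_iff1)
    then show ?thesis
      using square[OF x(1)] measurable_atom_below[OF _ E_sub[OF x(1)]] by blast
  qed
  ultimately show ?thesis using finA by (simp add: measurable_ra_def)
qed

end
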